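(* Let $n, j, r$ be non-negative integers with $r\geq 2$. Then $$\frac{1}{r-1}\,b_{\leq j,r}(n)=(j+1)\,|\mathcal{O}_{j+1,r}(n)|=(j+1)\,|\mathcal{D}_{j+1,r}(n)|,$$ where $$b_{\leq j,r}(n)=\sum_{\lambda\in \mathcal{O}_{\leq j,r}(n)} \ell(\lambda)-\sum_{\lambda\in \mathcal{D}_{\leq j,r}(n)} \ell(\lambda).$$
   Context: A partition $\lambda$ of a non-negative integer $n$ is a non-increasing finite sequence of positive integers $(\lambda_1,\ldots,\lambda_\ell)$ (its parts) with sum $n$; the empty partition is the only partition of $0$. The length $\ell(\lambda)$ is the number of parts of $\lambda$, counted with multiplicity. For integers $j\ge 0$, $r\ge 2$, $n \ge 0$: - $\mathcal{O}_{j,r}(n)$ (respectively $\mathcal{O}_{\leq j,r}(n)$) is the set of partitions of $n$ with exactly $j$ (respectively at most $j$) different parts divisible by $r$. Here different means distinct part values; these parts may be repeated. - $\mathcal{D}_{j,r}(n)$ (respectively $\mathcal{D}_{\leq j,r}(n)$) is the set of partitions of $n$ in which exactly $j$ (respectively at most $j$) different parts are repeated at least $r$ times (i.e. have multiplicity at least $r$), all other parts appearing at most $r-1$ times. The quantity $b_{\leq j,r}(n)$ is an integer defined by subtraction in $\mathbb{Z}$. *)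

theory Defs
  imports Complex_Main
begin

definition partitions :: "nat \<Rightarrow> nat list set" where
  "partitions n = {xs. sorted_wrt (\<ge>) xs \<and> (\<forall>x\<in>set xs. 0 < x) \<and> sum_list xs = n}"

definition O_eq :: "nat \<Rightarrow> nat \<Rightarrow> nat \<Rightarrow> nat list set" where
  "O_eq j r n = {xs \<in> partitions n. card {x \<in> set xs. r dvd x} = j}"

definition O_le :: "nat \<Rightarrow> nat \<Rightarrow> nat \<Rightarrow> nat list set" where
  "O_le j r n = {xs \<in> partitions n. card {x \<in> set xs. r dvd x} \<le> j}"

(* That all other parts appear at most r - 1 times needs no separate condition:
   every part of multiplicity at least r is counted by the cardinality. *)

definition D_eq :: "nat \<Rightarrow> nat \<Rightarrow> nat \<Rightarrow> nat list set" where
  "D_eq j r n = {xs \<in> partitions n. card {x \<in> set xs. r \<le> count_list xs x} = j}"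

definition D_le :: "nat \<Rightarrow> nat \<Rightarrow> nat \<Rightarrow> nat list set" where
  "D_le j r n = {xs \<in> partitions n. card {x \<in> set xs. r \<le> count_list xs x} \<le> j}"

definition b_le :: "nat \<Rightarrow> nat \<Rightarrow> nat \<Rightarrow> int" where
  "b_le j r n = (\<Sum>xs\<in>O_le j r n. int (length xs)) - (\<Sum>xs\<in>D_le j r n. int (length xs))"

(* The sums and cardinalities range over finite sets, so they have their usual meaning. *)

lemma finite_partitions: "finite (partitions n)"
proof (rule finite_subset)
  have len: "length xs \<le> sum_list xs" if "\<forall>x\<in>set xs. 0 < x" for xs :: "nat list"
    using that by (induction xs) auto
  show "partitions n \<subseteq> {xs. set xs \<subseteq> {..n} \<and> length xs \<le> n}"
    using len by (auto simp: partitions_def intro: member_le_sum_list)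
  show "finite {xs. set xs \<subseteq> {..n} \<and> length xs \<le> n}"
    by (rule finite_lists_length_le) simp
qed

lemma finite_O_D:
  "finite (O_eq j r n)" "finite (O_le j r n)" "finite (D_eq j r n)" "finite (D_le j r n)"
  by (auto simp: O_eq_def O_le_def D_eq_def D_le_def finite_partitions)

end

theory Submission
  imports Defs "HOL-Library.Multiset"
begin

text \<open>
  The idea is to count partitions together with a set of \<open>k\<close> marked special parts, instead of
  partitions with exactly \<open>k\<close> special ones; that is, to compare the binomial moments
  \<open>\<Sum>\<lambda>. (s \<lambda> choose k)\<close> of the two statistics \<open>s\<close> (the number of different parts divisible by \<open>r\<close>,
  respectively repeated at least \<open>r\<close> times).

  Both statistics count the positive integers \<open>m\<close> whose block \<open>E m\<close> is contained in \<open>\<lambda>\<close>: the block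
  is a single part \<open>r * m\<close> in the first case and \<open>r\<close> copies of the part \<open>m\<close> in the second. Either
  way it has sum \<open>r * m\<close>, and distinct blocks are disjoint. Hence deleting the blocks of a marked
  set \<open>S\<close> is a bijection from the partitions of \<open>n\<close> that contain all of these blocks to the
  arbitrary partitions of \<open>n - r * \<Sum>S\<close>, a description that no longer depends on the kind of block.
  So both statistics have the same binomial moments \<open>A k\<close>. Deletion removes \<open>k\<close> parts in the first
  case and \<open>r * k\<close> in the second, so the moments weighted by length differ by \<open>(r - 1) * k * A k\<close>
  (lemmas \<open>sum_choose_marks\<close> and \<open>size_weighted_choose_moments_marks\<close>).

  A function on \<open>{0..N}\<close> is a combination of the functions \<open>i \<mapsto> i choose k\<close>, so equality of
  moments extends to equality for all test functions (lemma \<open>linear_vanishes_if_vanishes_on_choose\<close>).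
  Here \<open>k * A k\<close> corresponds to the operator \<open>F \<mapsto> i * (F i - F (i - 1))\<close>, because of the identity
  \<open>i * ((i choose k) - ((i - 1) choose k)) = k * (i choose k)\<close>. For \<open>F\<close> the indicator of \<open>{..j}\<close>
  that operator gives \<open>- (j + 1)\<close> at \<open>i = j + 1\<close> and \<open>0\<close> elsewhere, whence the theorem.
\<close>

section \<open>From binomial moments to arbitrary test functions\<close>

lemma newton_interpolation:
  fixes F :: "nat \<Rightarrow> int"
  shows "\<exists>a. \<forall>i\<le>N. F i = (\<Sum>k\<le>N. a k * int (i choose k))"
proof (induction N)
  case 0
  show ?case by (rule exI[of _ F]) simp
next
  case (Suc N)
  then obtain a where a: "\<And>i. i \<le> N \<Longrightarrow> F i = (\<Sum>k\<le>N. a k * int (i choose k))" by blast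
  define b where "b = a(Suc N := F (Suc N) - (\<Sum>k\<le>N. a k * int (Suc N choose k)))"
  have ab: "(\<Sum>k\<le>N. b k * int (i choose k)) = (\<Sum>k\<le>N. a k * int (i choose k))" for i
    by (intro sum.cong) (auto simp: b_def)
  have "F i = (\<Sum>k\<le>Suc N. b k * int (i choose k))" if "i \<le> Suc N" for i
  proof (cases "i = Suc N")
    case True
    then show ?thesis by (simp only: sum.atMost_Suc ab) (simp add: b_def)
  next
    case False
    then show ?thesis using that a[of i] by (simp only: sum.atMost_Suc ab) simp
  qed
  then show ?case by blast
qed

text \<open>
  The functions \<open>i choose k\<close> span all functions on \<open>{0..N}\<close>, and \<open>L\<close> sees no other arguments.
  It is stated for an abstract \<open>L\<close> because it serves both for plain differences of moments and for
  a functional that contains the difference operator.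
\<close>

lemma linear_vanishes_if_vanishes_on_choose:
  fixes L :: "(nat \<Rightarrow> int) \<Rightarrow> int"
  assumes add: "\<And>F G. L (\<lambda>i. F i + G i) = L F + L G"
    and scale: "\<And>c F. L (\<lambda>i. c * F i) = c * L F"
    and cong: "\<And>F G. (\<And>i. i \<le> N \<Longrightarrow> F i = G i) \<Longrightarrow> L F = L G"
    and choose: "\<And>k. L (\<lambda>i. int (i choose k)) = 0"
  shows "L F = 0"
proof -
  obtain a where a: "\<And>i. i \<le> N \<Longrightarrow> F i = (\<Sum>k\<le>N. a k * int (i choose k))"
    using newton_interpolation[of N F] by blast
  have "L (\<lambda>i. \<Sum>k\<le>K. a k * int (i choose k)) = 0" for K
  proof (induction K)
    case 0
    show ?case using scale[of "a 0" "\<lambda>i. int (i choose 0)"] choose[of 0] by simp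
  qed (simp add: add scale choose)
  then show ?thesis using cong[OF a] by simp
qed

text \<open>
  On the basis \<open>i choose k\<close>, multiplying by \<open>k\<close> is the operator \<open>F \<mapsto> i * (F i - F (i - 1))\<close>. At
  \<open>i = 0\<close> truncated subtraction does no harm because of the factor \<open>i\<close>.
\<close>

lemma times_choose_diff:
  "int i * (int (i choose k) - int (i - 1 choose k)) = int k * int (i choose k)"
proof (cases i)
  case (Suc i')
  show ?thesis
  proof (cases k)
    case (Suc k')
    have "Suc i' * (i' choose k') = Suc k' * (Suc i' choose Suc k')"
      by (simp only: Suc_times_binomial_eq mult.commute)
    then have "int (Suc i') * int (i' choose k') = int (Suc k') * int (Suc i' choose Suc k')"
      by (metis of_nat_mult)
    then show ?thesis using \<open>i = Suc i'\<close> Suc by simp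
  qed simp
qed (cases k; simp)

lemma card_eq_of_choose_moments:
  assumes fin: "finite X"
    and moments: "\<And>k. (\<Sum>x\<in>X. int (s x choose k)) = (\<Sum>x\<in>X. int (t x choose k))"
  shows "card {x \<in> X. s x = i} = card {x \<in> X. t x = i}"
proof -
  define L where "L F = (\<Sum>x\<in>X. F (s x) - F (t x))" for F :: "nat \<Rightarrow> int"
  obtain N where N: "\<And>x. x \<in> X \<Longrightarrow> s x \<le> N \<and> t x \<le> N"
  proof
    show "s x \<le> (\<Sum>x\<in>X. s x + t x) \<and> t x \<le> (\<Sum>x\<in>X. s x + t x)" if "x \<in> X" for x
      using member_le_sum[OF that, of "\<lambda>x. s x + t x"] fin by simp
  qed
  have "L (\<lambda>m. of_bool (m = i)) = 0"
  proof (rule linear_vanishes_if_vanishes_on_choose[of L N])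
    show "L F = L G" if "\<And>i. i \<le> N \<Longrightarrow> F i = G i" for F G
      unfolding L_def using N that by (intro sum.cong) auto
  qed (auto simp: L_def sum.distrib sum_subtractf sum_distrib_left moments algebra_simps)
  then show ?thesis
    using fin by (simp add: L_def sum_subtractf of_bool_def sum.If_cases Int_def)
qed

text \<open>
  The hypothesis says that a certain functional vanishes on the functions \<open>i choose k\<close>, once the
  factor \<open>k\<close> has been expressed by the difference operator. The conclusion is the value of that
  functional at the indicator of \<open>{..j}\<close>, which jumps only between \<open>j\<close> and \<open>j + 1\<close>.
\<close>

lemma sum_le_diff_of_choose_moments:
  fixes w :: "'a \<Rightarrow> int"
  assumes fin: "finite X"
    and moments: "\<And>k. (\<Sum>x\<in>X. int (t x choose k) * w x) - (\<Sum>x\<in>X. int (s x choose k) * w x)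
      = c * (int k * (\<Sum>x\<in>X. int (s x choose k)))"
  shows "(\<Sum>x\<in>{x \<in> X. s x \<le> j}. w x) - (\<Sum>x\<in>{x \<in> X. t x \<le> j}. w x)
    = c * (int (j + 1) * int (card {x \<in> X. s x = j + 1}))"
proof -
  define L where "L F = (\<Sum>x\<in>X. F (t x) * w x) - (\<Sum>x\<in>X. F (s x) * w x)
    - c * (\<Sum>x\<in>X. int (s x) * (F (s x) - F (s x - 1)))" for F :: "nat \<Rightarrow> int"
  obtain N where N: "\<And>x. x \<in> X \<Longrightarrow> s x \<le> N \<and> t x \<le> N"
  proof
    show "s x \<le> (\<Sum>x\<in>X. s x + t x) \<and> t x \<le> (\<Sum>x\<in>X. s x + t x)" if "x \<in> X" for x
      using member_le_sum[OF that, of "\<lambda>x. s x + t x"] fin by simp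
  qed
  have "L (\<lambda>m. of_bool (m \<le> j)) = 0"
  proof (rule linear_vanishes_if_vanishes_on_choose[of L N])
    show "L F = L G" if "\<And>i. i \<le> N \<Longrightarrow> F i = G i" for F G
    proof -
      have "F (s x) = G (s x)" "F (t x) = G (t x)" "F (s x - 1) = G (s x - 1)" if "x \<in> X" for x
        using N[OF that] \<open>\<And>i. i \<le> N \<Longrightarrow> F i = G i\<close> by auto
      then show ?thesis unfolding L_def by simp
    qed
    show "L (\<lambda>i. int (i choose k)) = 0" for k
      unfolding L_def times_choose_diff using moments[of k] by (simp add: sum_distrib_left)
  qed (auto simp: L_def sum.distrib sum_subtractf sum_distrib_left algebra_simps)
  moreover have "int (s x) * (of_bool (s x \<le> j) - of_bool (s x - 1 \<le> j))
      = - (int (j + 1) * of_bool (s x = j + 1))" for x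
    by (auto simp: of_bool_def)
  ultimately have "(\<Sum>x\<in>X. of_bool (t x \<le> j) * w x) - (\<Sum>x\<in>X. of_bool (s x \<le> j) * w x)
      + c * (int (j + 1) * (\<Sum>x\<in>X. of_bool (s x = j + 1))) = 0"
    unfolding L_def by (simp only: sum_negf sum_distrib_left[symmetric])
  moreover have "(\<Sum>x\<in>X. of_bool (Q x) * w x) = (\<Sum>x\<in>{x \<in> X. Q x}. w x)" for Q
    using fin by (simp add: of_bool_def if_distrib[of "\<lambda>b. b * _"] sum.inter_filter cong: if_cong)
  moreover have "(\<Sum>x\<in>X. of_bool (s x = j + 1)) = int (card {x \<in> X. s x = j + 1})"
    using fin by (simp add: of_bool_def sum.If_cases Int_def)
  ultimately show ?thesis by simp
qed

section \<open>Partitions as multisets\<close>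

definition mset_partitions :: "nat \<Rightarrow> nat multiset set" where
  "mset_partitions n = {M. 0 \<notin># M \<and> sum_mset M = n}"

lemma bij_betw_mset_partitions:
  "bij_betw mset {xs \<in> partitions n. Q (mset xs)} {M \<in> mset_partitions n. Q M}"
proof (rule bij_betw_byWitness[where f' = "\<lambda>M. rev (sorted_list_of_multiset M)"])
  show "\<forall>xs\<in>{xs \<in> partitions n. Q (mset xs)}. rev (sorted_list_of_multiset (mset xs)) = xs"
  proof
    fix xs assume "xs \<in> {xs \<in> partitions n. Q (mset xs)}"
    then have "sorted (rev xs)" by (auto simp: partitions_def sorted_wrt_rev)
    then have "sort xs = rev xs" by (intro properties_for_sort) auto
    then show "rev (sorted_list_of_multiset (mset xs)) = xs" by simp
  qed
  have "sum_list (sorted_list_of_multiset M) = sum_mset M" for M :: "nat multiset"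
    by (metis mset_sorted_list_of_multiset sum_mset_sum_list)
  then show "(\<lambda>M. rev (sorted_list_of_multiset M)) ` {M \<in> mset_partitions n. Q M}
      \<subseteq> {xs \<in> partitions n. Q (mset xs)}"
    by (auto simp: partitions_def mset_partitions_def sorted_wrt_rev intro!: gr0I)
qed (auto simp: partitions_def mset_partitions_def sum_mset_sum_list)

lemma finite_mset_partitions: "finite (mset_partitions n)"
  using bij_betw_finite[OF bij_betw_mset_partitions[of n "\<lambda>_. True"]] finite_partitions by simp

section \<open>Counting partitions with marked blocks\<close>

text \<open>
  The pairs that remain after the marked blocks have been deleted: the set \<open>S\<close> of marks and the
  rest \<open>N\<close> of the partition. Only \<open>r\<close> enters, not the blocks, so that different families can be
  compared.
\<close>

definition marked_pairs_sum :: "nat \<Rightarrow> nat \<Rightarrow> nat \<Rightarrow> (nat multiset \<Rightarrow> int) \<Rightarrow> int" where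
  "marked_pairs_sum r n k h = (\<Sum>S | S \<subseteq> {1..n} \<and> card S = k.
    \<Sum>N | 0 \<notin># N \<and> sum_mset N + r * \<Sum>S = n. h N)"

text \<open>
  A special part of a partition is encoded by a positive integer \<open>m\<close> whose block \<open>E m\<close> the
  partition contains. The parameter \<open>c\<close>, the number of parts in a block, is the only respect in which the two families
  of interest differ as far as the sums below are concerned.
\<close>

locale block_family =
  fixes r c :: nat and E :: "nat \<Rightarrow> nat multiset"
  assumes r_pos: "0 < r"
    and sum_block: "sum_mset (E m) = r * m"
    and size_block: "size (E m) = c"
    and disjoint_blocks: "m \<noteq> m' \<Longrightarrow> E m \<inter># E m' = {#}"
    and zero_notin_block: "0 < m \<Longrightarrow> 0 \<notin># E m"
begin

definition marks :: "nat multiset \<Rightarrow> nat set" where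
  "marks M = {m. 0 < m \<and> E m \<subseteq># M}"

lemma sum_mset_sum_blocks: "sum_mset (\<Sum>m\<in>S. E m) = r * \<Sum>S"
  by (induction S rule: infinite_finite_induct) (simp_all add: sum_block distrib_left)

text \<open>
  Marked blocks can be removed all at once: since they are disjoint, their sum is their supremum in
  the subset order of multisets.
\<close>

lemma sum_blocks_subset_iff:
  assumes "finite S"
  shows "(\<Sum>m\<in>S. E m) \<subseteq># M \<longleftrightarrow> (\<forall>m\<in>S. E m \<subseteq># M)"
  using assms
proof (induction S)
  case (insert a S)
  have "E a \<inter># (\<Sum>m\<in>S. E m) = {#}"
    using insert.hyps
  proof (induction S)
    case (insert b S)
    then show ?case
      using disjoint_blocks[of a b]
      by (auto simp: disjunct_not_in)
  qed simp
  then have "E a \<union># (\<Sum>m\<in>S. E m) = E a + (\<Sum>m\<in>S. E m)"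
    by (metis diff_zero union_diff_inter_eq_sup)
  then have "(\<Sum>m\<in>insert a S. E m) \<subseteq># M \<longleftrightarrow> E a \<subseteq># M \<and> (\<Sum>m\<in>S. E m) \<subseteq># M"
    using insert.hyps by (metis le_sup_iff subset_mset.le_sup_iff sum.insert)
  then show ?case using insert.IH by simp
qed simp

lemma marks_subset:
  assumes "M \<in> mset_partitions n"
  shows "marks M \<subseteq> {1..n}"
proof
  fix m assume m: "m \<in> marks M"
  then obtain N where "M = E m + N" by (auto simp: marks_def dest: mset_subset_eq_exists_conv[THEN iffD1])
  then have "r * m \<le> n" using assms by (auto simp: mset_partitions_def sum_block)
  moreover have "m \<le> r * m" using r_pos by simp
  ultimately have "m \<le> n" by (rule order_trans[rotated])
  then show "m \<in> {1..n}" using m by (auto simp: marks_def)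
qed

text \<open>
  The binomial coefficient counts the ways to mark \<open>k\<close> blocks of \<open>M\<close>, and deleting the marked
  blocks leaves \<open>N\<close>. On the right-hand side the blocks occur only in the argument of \<open>h\<close>, so for
  \<open>h\<close> constant, or depending on the size alone, the sum is the same for all families with the same
  \<open>r\<close> and block size. The condition on \<open>N\<close> avoids the truncated difference \<open>n - r * \<Sum>S\<close>, so that
  the inner sum is empty if \<open>S\<close> is too large.
\<close>

lemma sum_choose_marks:
  "(\<Sum>M\<in>mset_partitions n. int (card (marks M) choose k) * h M)
    = (\<Sum>S | S \<subseteq> {1..n} \<and> card S = k.
        \<Sum>N | 0 \<notin># N \<and> sum_mset N + r * \<Sum>S = n. h (N + (\<Sum>m\<in>S. E m)))"
proof -
  have "(\<Sum>M\<in>mset_partitions n. int (card (marks M) choose k) * h M)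
      = (\<Sum>M\<in>mset_partitions n. \<Sum>S | S \<in> {S. S \<subseteq> {1..n} \<and> card S = k} \<and> S \<subseteq> marks M. h M)"
  proof (rule sum.cong)
    fix M assume M: "M \<in> mset_partitions n"
    (* A range of S that does not depend on M is what allows the sums to be interchanged. *)
    have "{S. S \<in> {S. S \<subseteq> {1..n} \<and> card S = k} \<and> S \<subseteq> marks M} = {S. S \<subseteq> marks M \<and> card S = k}"
      using marks_subset[OF M] by auto
    moreover have "finite (marks M)" using marks_subset[OF M] by (rule finite_subset) simp
    ultimately show "int (card (marks M) choose k) * h M
        = (\<Sum>S | S \<in> {S. S \<subseteq> {1..n} \<and> card S = k} \<and> S \<subseteq> marks M. h M)"
      by (simp add: n_subsets)
  qed simp
  also have "\<dots> = (\<Sum>S\<in>{S. S \<subseteq> {1..n} \<and> card S = k}.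
      \<Sum>M | M \<in> mset_partitions n \<and> S \<subseteq> marks M. h M)"
    by (rule sum.swap_restrict) (auto simp: finite_mset_partitions)
  also have "\<dots> = (\<Sum>S | S \<subseteq> {1..n} \<and> card S = k.
        \<Sum>N | 0 \<notin># N \<and> sum_mset N + r * \<Sum>S = n. h (N + (\<Sum>m\<in>S. E m)))"
  proof (rule sum.cong)
    fix S assume S: "S \<in> {S. S \<subseteq> {1..n} \<and> card S = k}"
    then have fin: "finite S" and pos: "\<And>m. m \<in> S \<Longrightarrow> 0 < m"
      by (auto intro: finite_subset)
    have zero: "0 \<notin># (\<Sum>m\<in>S. E m)"
      using fin pos zero_notin_block by (auto simp: set_mset_sum)
    have sub: "S \<subseteq> marks M \<longleftrightarrow> (\<Sum>m\<in>S. E m) \<subseteq># M" for M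
      using pos by (auto simp: sum_blocks_subset_iff[OF fin] marks_def)
    show "(\<Sum>M | M \<in> mset_partitions n \<and> S \<subseteq> marks M. h M)
        = (\<Sum>N | 0 \<notin># N \<and> sum_mset N + r * \<Sum>S = n. h (N + (\<Sum>m\<in>S. E m)))"
    proof (rule sum.reindex_bij_witness[where i = "\<lambda>N. N + (\<Sum>m\<in>S. E m)"
          and j = "\<lambda>M. M - (\<Sum>m\<in>S. E m)"])
      fix M assume "M \<in> {M. M \<in> mset_partitions n \<and> S \<subseteq> marks M}"
      then have M: "0 \<notin># M" "sum_mset M = n" "(\<Sum>m\<in>S. E m) \<subseteq># M"
        by (auto simp: mset_partitions_def sub)
      show eq: "M - (\<Sum>m\<in>S. E m) + (\<Sum>m\<in>S. E m) = M"
        using M(3) by (rule subset_mset.diff_add)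
      then show "h (M - (\<Sum>m\<in>S. E m) + (\<Sum>m\<in>S. E m)) = h M" by simp
      have "sum_mset (M - (\<Sum>m\<in>S. E m)) + r * \<Sum>S = n"
        using arg_cong[OF eq, of sum_mset] M(2) by (simp add: sum_mset_sum_blocks)
      then show "M - (\<Sum>m\<in>S. E m) \<in> {N. 0 \<notin># N \<and> sum_mset N + r * \<Sum>S = n}"
        using M(1) by (auto dest: in_diffD)
    qed (use zero in \<open>auto simp: mset_partitions_def sub sum_mset_sum_blocks\<close>)
  qed simp
  finally show ?thesis .
qed

lemma choose_moments_marks:
  "(\<Sum>M\<in>mset_partitions n. int (card (marks M) choose k)) = marked_pairs_sum r n k (\<lambda>_. 1)"
  using sum_choose_marks[of k "\<lambda>_. 1" n] by (simp add: marked_pairs_sum_def)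

lemma size_weighted_choose_moments_marks:
  "(\<Sum>M\<in>mset_partitions n. int (card (marks M) choose k) * int (size M))
    = marked_pairs_sum r n k (\<lambda>N. int (size N)) + int c * (int k * marked_pairs_sum r n k (\<lambda>_. 1))"
  unfolding sum_choose_marks marked_pairs_sum_def sum_distrib_left sum.distrib[symmetric]
  by (intro sum.cong) (auto simp: size_block)

end

section \<open>The two block families\<close>

lemma block_family_multiple:
  assumes "0 < r"
  shows "block_family r 1 (\<lambda>m. {#r * m#})"
  using assms by unfold_locales auto

lemma block_family_repeated:
  assumes "0 < r"
  shows "block_family r r (\<lambda>m. replicate_mset r m)"
  using assms by unfold_locales (auto simp: disjunct_not_in)

lemma card_marks_multiple:
  assumes "0 < r" and "M \<in> mset_partitions n"
  shows "card (block_family.marks (\<lambda>m. {#r * m#}) M) = card {x \<in> set_mset M. r dvd x}"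
proof -
  have "(*) r ` {m. 0 < m \<and> r * m \<in># M} = {x \<in> set_mset M. r dvd x}"
    using assms(2) by (auto simp: mset_partitions_def dvd_def image_iff intro!: gr0I)
  moreover have "inj_on ((*) r) {m. 0 < m \<and> r * m \<in># M}"
    using assms(1) by (auto simp: inj_on_def)
  ultimately show ?thesis
    using card_image[of "(*) r" "{m. 0 < m \<and> r * m \<in># M}"]
    by (simp add: block_family.marks_def[OF block_family_multiple[OF assms(1)]])
qed

lemma card_marks_repeated:
  assumes "0 < r" and "M \<in> mset_partitions n"
  shows "card (block_family.marks (\<lambda>m. replicate_mset r m) M) = card {x \<in> set_mset M. r \<le> count M x}"
proof -
  have "{m. 0 < m \<and> r \<le> count M m} = {x \<in> set_mset M. r \<le> count M x}"
    using assms by (auto simp: mset_partitions_def intro!: gr0I simp: count_greater_zero_iff[symmetric]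
        simp del: count_greater_zero_iff)
  then show ?thesis
    by (simp add: block_family.marks_def[OF block_family_repeated[OF assms(1)]]
        count_le_replicate_mset_subset_eq[symmetric])
qed

theorem theorem2:
  fixes n j r :: nat
  assumes "r \<ge> 2"
  shows "1 / (of_nat r - 1) * of_int (b_le j r n) = (of_nat ((j + 1) * card (O_eq (j + 1) r n)) :: rat)
    \<and> (j + 1) * card (O_eq (j + 1) r n) = (j + 1) * card (D_eq (j + 1) r n)"
proof -
  have r: "0 < r" using assms by simp
  interpret O: block_family r 1 "\<lambda>m. {#r * m#}" by (rule block_family_multiple[OF r])
  interpret D: block_family r r "\<lambda>m. replicate_mset r m" by (rule block_family_repeated[OF r])
  define s where "s M = card {x \<in> set_mset M. r dvd x}" for M :: "nat multiset"
  define t where "t M = card {x \<in> set_mset M. r \<le> count M x}" for M :: "nat multiset"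
  define P where "P = mset_partitions n"
  have st: "s M = card (O.marks M)" "t M = card (D.marks M)" if "M \<in> P" for M
    using that card_marks_multiple[OF r] card_marks_repeated[OF r] by (simp_all add: P_def s_def t_def)
  have fin: "finite P" by (simp add: P_def finite_mset_partitions)
  have moment_s: "(\<Sum>M\<in>P. int (s M choose k)) = marked_pairs_sum r n k (\<lambda>_. 1)" for k
    using O.choose_moments_marks[of k n, folded P_def] by (simp add: st(1))
  have moment_t: "(\<Sum>M\<in>P. int (t M choose k)) = marked_pairs_sum r n k (\<lambda>_. 1)" for k
    using D.choose_moments_marks[of k n, folded P_def] by (simp add: st(2))
  have cards: "card {M \<in> P. s M = j + 1} = card {M \<in> P. t M = j + 1}"
    by (rule card_eq_of_choose_moments[OF fin]) (simp add: moment_s moment_t)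
  have "(\<Sum>M\<in>P. int (t M choose k) * int (size M)) - (\<Sum>M\<in>P. int (s M choose k) * int (size M))
      = (int r - 1) * (int k * (\<Sum>M\<in>P. int (s M choose k)))" for k
    using O.size_weighted_choose_moments_marks[of k n] D.size_weighted_choose_moments_marks[of k n]
    unfolding moment_s by (simp add: st P_def[symmetric] left_diff_distrib)
  from sum_le_diff_of_choose_moments[OF fin this]
  have sizes: "(\<Sum>M\<in>{M \<in> P. s M \<le> j}. int (size M)) - (\<Sum>M\<in>{M \<in> P. t M \<le> j}. int (size M))
      = (int r - 1) * (int (j + 1) * int (card {M \<in> P. s M = j + 1}))" .
  have sets:
    "O_eq i r n = {xs \<in> partitions n. s (mset xs) = i}"
    "O_le i r n = {xs \<in> partitions n. s (mset xs) \<le> i}"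
    "D_eq i r n = {xs \<in> partitions n. t (mset xs) = i}"
    "D_le i r n = {xs \<in> partitions n. t (mset xs) \<le> i}" for i
    by (simp_all add: O_eq_def O_le_def D_eq_def D_le_def s_def t_def count_mset)
  note bij = bij_betw_mset_partitions[of n, folded P_def]
  have lengths: "(\<Sum>xs\<in>{xs \<in> partitions n. Q (mset xs)}. int (length xs))
      = (\<Sum>M\<in>{M \<in> P. Q M}. int (size M))" for Q
    using sum.reindex_bij_betw[OF bij, of "\<lambda>M. int (size M)" Q] by simp
  have O: "card (O_eq (j + 1) r n) = card {M \<in> P. s M = j + 1}"
    unfolding sets by (rule bij_betw_same_card[OF bij])
  have D: "card (D_eq (j + 1) r n) = card {M \<in> P. t M = j + 1}"
    unfolding sets by (rule bij_betw_same_card[OF bij])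
  have "b_le j r n = (int r - 1) * (int (j + 1) * int (card (O_eq (j + 1) r n)))"
    unfolding b_le_def O sets(2,4)
      lengths[of "\<lambda>M. s M \<le> j"] lengths[of "\<lambda>M. t M \<le> j"] by (rule sizes)
  then have "of_int (b_le j r n)
      = (of_nat r - 1) * (of_nat ((j + 1) * card (O_eq (j + 1) r n)) :: rat)"
    by (simp add: distrib_right)
  moreover have "(of_nat r - 1 :: rat) \<noteq> 0" using assms by simp
  ultimately show ?thesis using O D cards by simp
qed

end
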